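(* Let $L>0$, $f\in\mathcal F_L(\mathbb R^n)$, $x_0\in\mathbb R^n$, and let $(x_k)_{k\in\mathbb N}$ be the trajectory of gradient descent $x_{k+1}:=x_k-\eta_k\nabla f(x_k)$ with step sizes $\eta_k>0$ and initial point $x_0$. Let $k\ge 1$ and suppose $\eta_i\le 1/L$ for all $i\le k-1$. Then for every $p\in\operatorname{dom} f^*$, $$\|\nabla f(x_k)\|^2-\|p\|^2\le\frac{2D_f(x_0,p)}{a_k},\qquad\text{where } a_k:=\sum_{i=0}^{k-1}\eta_i .$$
   Context: $\|\cdot\|$ and $\langle\cdot,\cdot\rangle$ are the Euclidean norm and inner product on $\mathbb R^n$. For $L>0$, $\mathcal F_L(\mathbb R^n)$ is the set of finite-valued differentiable convex functions $f:\mathbb R^n\to\mathbb R$ whose gradient is $L$-Lipschitz. The Legendre--Fenchel conjugate is $f^*(p):=\sup_{x\in\mathbb R^n}\{\langle p,x\rangle-f(x)\}\in\mathbb R\cup\{\infty\}$, and $\operatorname{dom} f^*:=\{p\in\mathbb R^n: f^*(p)<\infty\}$. The dual divergence is $D_f(x,p):=f(x)+f^*(p)-\langle p,x\rangle$. *)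

theory Defs
  imports "HOL-Analysis.Analysis"
begin

definition gradient :: "('a::euclidean_space \<Rightarrow> real) \<Rightarrow> 'a \<Rightarrow> 'a" where
  "gradient f x = (THE g. GDERIV f x :> g)"

lemma GDERIV_gradient:
  fixes f :: "'a::euclidean_space \<Rightarrow> real"
  assumes "f differentiable (at x)"
  shows "GDERIV f x :> gradient f x"
proof -
  obtain D where D: "(f has_derivative D) (at x)"
    using assms by (auto simp: differentiable_def)
  then interpret D: linear D
    by (rule has_derivative_linear)
  define g where "g = (\<Sum>b\<in>Basis. D b *\<^sub>R b)"
  have "D h = h \<bullet> g" for h
  proof -
    have "D h = D (\<Sum>b\<in>Basis. (h \<bullet> b) *\<^sub>R b)"
      by (simp add: euclidean_representation)
    also have "\<dots> = h \<bullet> g"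
      by (simp add: D.sum D.scale g_def inner_sum_right mult.commute)
    finally show ?thesis .
  qed
  then have "D = (\<lambda>h. h \<bullet> g)"
    by auto
  with D have "GDERIV f x :> g"
    by (simp add: gderiv_def)
  moreover have "g' = g''" if "GDERIV f x :> g'" "GDERIV f x :> g''" for g' g''
  proof -
    have "(\<lambda>h. h \<bullet> g') = (\<lambda>h. h \<bullet> g'')"
      using has_derivative_unique that unfolding gderiv_def by blast
    then have "h \<bullet> g' = h \<bullet> g''" for h
      by meson
    then show ?thesis
      by (metis vector_eq_ldot)
  qed
  ultimately show ?thesis
    unfolding gradient_def by (metis theI)
qed

definition smooth_convex :: "real \<Rightarrow> ('a::euclidean_space \<Rightarrow> real) set" where
  "smooth_convex L =
     {f. (\<forall>x. f differentiable (at x)) \<and> convex_on UNIV f \<and> L-lipschitz_on UNIV (gradient f)}"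

definition conjugate :: "('a::euclidean_space \<Rightarrow> real) \<Rightarrow> 'a \<Rightarrow> ereal" where
  "conjugate f p = (SUP x. ereal (p \<bullet> x - f x))"

definition conjugate_dom :: "('a::euclidean_space \<Rightarrow> real) \<Rightarrow> 'a set" where
  "conjugate_dom f = {p. conjugate f p < \<infinity>}"

definition dual_divergence :: "('a::euclidean_space \<Rightarrow> real) \<Rightarrow> 'a \<Rightarrow> 'a \<Rightarrow> ereal" where
  "dual_divergence f x p = ereal (f x) + conjugate f p - ereal (p \<bullet> x)"

end

theory Submission
  imports Defs
begin

text \<open>
  Cocoercivity bounds the decrease of \<open>f\<close> in step \<open>i\<close> from below by
  \<open>\<eta>\<^sub>i (\<parallel>g\<^sub>i\<parallel>\<^sup>2 + \<parallel>g\<^sub>i\<^sub>+\<^sub>1\<parallel>\<^sup>2) / 2\<close>, where \<open>g\<^sub>i = \<nabla>f(x\<^sub>i)\<close>, and makes \<open>\<parallel>g\<^sub>i\<parallel>\<close> nonincreasing.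
  Since \<open>\<langle>p, g\<^sub>i\<rangle> \<le> (\<parallel>p\<parallel>\<^sup>2 + \<parallel>g\<^sub>i\<parallel>\<^sup>2) / 2\<close>, the function \<open>f - \<langle>p, \<cdot>\<rangle>\<close> then decreases in step \<open>i\<close> by at
  least \<open>\<eta>\<^sub>i (\<parallel>g\<^sub>k\<parallel>\<^sup>2 - \<parallel>p\<parallel>\<^sup>2) / 2\<close>.  Its total decrease from \<open>x\<^sub>0\<close> to \<open>x\<^sub>k\<close> is at most
  \<open>D\<^sub>f(x\<^sub>0, p)\<close>, because its infimum is \<open>- f\<^sup>*(p)\<close>.
\<close>

lemma has_real_derivative_along_line:
  fixes f :: "'a::euclidean_space \<Rightarrow> real"
  assumes "f differentiable (at (x + t *\<^sub>R d))"
  shows "((\<lambda>t. f (x + t *\<^sub>R d)) has_real_derivative gradient f (x + t *\<^sub>R d) \<bullet> d) (at t)"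
proof -
  have "((\<lambda>t. x + t *\<^sub>R d) has_derivative (\<lambda>h. h *\<^sub>R d)) (at t)"
    by (auto intro!: derivative_eq_intros)
  moreover have "(f has_derivative (\<lambda>h. h \<bullet> gradient f (x + t *\<^sub>R d))) (at (x + t *\<^sub>R d))"
    using GDERIV_gradient[OF assms] by (simp add: gderiv_def)
  ultimately have "((\<lambda>t. f (x + t *\<^sub>R d)) has_derivative
      (\<lambda>h. (h *\<^sub>R d) \<bullet> gradient f (x + t *\<^sub>R d))) (at t)"
    by (rule has_derivative_compose)
  then show ?thesis
    unfolding has_field_derivative_def
    by (rule has_derivative_eq_rhs) (simp add: fun_eq_iff inner_commute)
qed

text \<open>On the line through \<open>x\<close> and \<open>y\<close> this is the tangent inequality
  in one variable, with the slope at 0 given by the chain rule.\<close>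

lemma convex_above_gradient:
  fixes f :: "'a::euclidean_space \<Rightarrow> real"
  assumes "convex_on UNIV f" and "f differentiable (at x)"
  shows "f x + gradient f x \<bullet> (y - x) \<le> f y"
proof -
  let ?\<phi> = "\<lambda>t. f (x + t *\<^sub>R (y - x))"
  have "convex_on UNIV ?\<phi>"
  proof (rule convex_onI)
    fix t a b :: real
    assume t: "0 < t" "t < 1"
    have "x + ((1 - t) *\<^sub>R a + t *\<^sub>R b) *\<^sub>R (y - x)
        = (1 - t) *\<^sub>R (x + a *\<^sub>R (y - x)) + t *\<^sub>R (x + b *\<^sub>R (y - x))"
      by (simp add: algebra_simps)
    then show "?\<phi> ((1 - t) *\<^sub>R a + t *\<^sub>R b) \<le> (1 - t) * ?\<phi> a + t * ?\<phi> b"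
      using convex_onD[OF assms(1), of t] t by simp
  qed simp
  moreover have "(?\<phi> has_real_derivative gradient f x \<bullet> (y - x)) (at 0)"
    using has_real_derivative_along_line[of f x 0 "y - x"] assms(2) by simp
  ultimately have "?\<phi> 1 - ?\<phi> 0 \<ge> gradient f x \<bullet> (y - x) * (1 - 0)"
    by (intro convex_on_imp_above_tangent) auto
  then show ?thesis
    by simp
qed

text \<open>Along the segment from \<open>x\<close> to \<open>y\<close>, the difference of the two
  sides has derivative at most 0, by Cauchy-Schwarz and the Lipschitz bound.\<close>

lemma lipschitz_gradient_upper_bound:
  fixes f :: "'a::euclidean_space \<Rightarrow> real"
  assumes diff: "\<And>z. f differentiable (at z)" and lip: "L-lipschitz_on UNIV (gradient f)"
  shows "f y \<le> f x + gradient f x \<bullet> (y - x) + L / 2 * (norm (y - x))\<^sup>2"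
proof -
  define d where "d = y - x"
  let ?\<phi> = "\<lambda>t. f (x + t *\<^sub>R d) - t * (gradient f x \<bullet> d) - L / 2 * t\<^sup>2 * (norm d)\<^sup>2"
  have "?\<phi> 1 \<le> ?\<phi> 0"
  proof (rule DERIV_nonpos_imp_nonincreasing[where f = ?\<phi>])
    fix t :: real
    assume t: "0 \<le> t" "t \<le> 1"
    let ?D = "gradient f (x + t *\<^sub>R d) \<bullet> d - gradient f x \<bullet> d - L * t * (norm d)\<^sup>2"
    have "(?\<phi> has_real_derivative ?D) (at t)"
      by (rule derivative_eq_intros has_real_derivative_along_line diff refl)+ simp
    moreover have "?D \<le> 0"
    proof -
      have "gradient f (x + t *\<^sub>R d) \<bullet> d - gradient f x \<bullet> d
          \<le> norm (gradient f (x + t *\<^sub>R d) - gradient f x) * norm d"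
        by (metis inner_diff_left norm_cauchy_schwarz)
      also have "\<dots> \<le> (L * norm (t *\<^sub>R d)) * norm d"
        using lipschitz_onD[OF lip, of "x + t *\<^sub>R d" x]
        by (intro mult_right_mono) (simp_all add: dist_norm)
      finally show ?thesis
        using t by (simp add: power2_eq_square mult.assoc)
    qed
    ultimately show "\<exists>D. (?\<phi> has_real_derivative D) (at t) \<and> D \<le> 0"
      by blast
  qed simp
  then show ?thesis
    by (simp add: d_def)
qed

text \<open>The tangent at \<open>y\<close> lies below the quadratic bound at \<open>x\<close>;
  comparing the two at a single point yields the extra quadratic term.\<close>

lemma smooth_convex_lower_bound:
  assumes "L > 0" and "f \<in> smooth_convex L"
  shows "f y + gradient f y \<bullet> (x - y) + (norm (gradient f x - gradient f y))\<^sup>2 / (2 * L) \<le> f x"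
proof -
  have f: "convex_on UNIV f" "\<And>z. f differentiable (at z)" "L-lipschitz_on UNIV (gradient f)"
    using assms(2) by (auto simp: smooth_convex_def)
  define d where "d = gradient f x - gradient f y"
  \<comment> \<open>The minimiser of the quadratic upper bound at \<open>x\<close> minus the linear lower bound at \<open>y\<close>.\<close>
  define z where "z = x - (1 / L) *\<^sub>R d"
  have "f y + gradient f y \<bullet> (z - y) \<le> f z"
    using f by (intro convex_above_gradient)
  also have "f z \<le> f x + gradient f x \<bullet> (z - x) + L / 2 * (norm (z - x))\<^sup>2"
    using f by (intro lipschitz_gradient_upper_bound)
  also have "(norm (z - x))\<^sup>2 = (norm d)\<^sup>2 / L\<^sup>2"
    using assms(1) by (simp add: z_def power_divide)
  also have "L / 2 * ((norm d)\<^sup>2 / L\<^sup>2) = (norm d)\<^sup>2 / (2 * L)"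
    using assms(1) by (simp add: power2_eq_square)
  finally have "f y + gradient f y \<bullet> (x - y) + d \<bullet> (x - z) - (norm d)\<^sup>2 / (2 * L) \<le> f x"
    by (simp add: d_def inner_diff)
  moreover have "d \<bullet> (x - z) = (norm d)\<^sup>2 / L"
    by (simp add: z_def power2_norm_eq_inner)
  ultimately show ?thesis
    using assms(1) by (simp add: d_def field_simps)
qed

context
  fixes f :: "'a::euclidean_space \<Rightarrow> real" and L \<eta> :: real and x y :: 'a
  assumes L: "L > 0" and f: "f \<in> smooth_convex L" and \<eta>: "\<eta> > 0" "\<eta> \<le> 1 / L"
    and y: "y = x - \<eta> *\<^sub>R gradient f x"
begin

text \<open>Both come from \<open>smooth_convex_lower_bound\<close>, used in each direction between
  \<open>x\<close> and \<open>y\<close>; as \<open>\<eta> \<le> 1 / L\<close>, its coefficient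
  \<open>1 / (2 * L)\<close> can be weakened to \<open>\<eta> / 2\<close>.\<close>

lemma gradient_step_inequalities:
  shows gradient_step_decrease:
      "f y + \<eta> / 2 * ((norm (gradient f x))\<^sup>2 + (norm (gradient f y))\<^sup>2) \<le> f x" (is ?decrease)
    and norm_gradient_step_le: "norm (gradient f y) \<le> norm (gradient f x)" (is ?norm)
proof -
  let ?g = "gradient f x" and ?h = "gradient f y"
  have "\<eta> / 2 \<le> 1 / (2 * L)"
    using \<eta> by (simp add: field_simps)
  from mult_right_mono[OF this, of "(norm (?g - ?h))\<^sup>2"]
  have le: "\<eta> / 2 * (norm (?g - ?h))\<^sup>2 \<le> (norm (?g - ?h))\<^sup>2 / (2 * L)"
    by simp
  have sq: "(norm (?g - ?h))\<^sup>2 = (norm ?g)\<^sup>2 - 2 * (?g \<bullet> ?h) + (norm ?h)\<^sup>2"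
    by (simp add: power2_norm_eq_inner inner_diff inner_commute)
  have "f y + \<eta> * (?g \<bullet> ?h) + \<eta> / 2 * (norm (?g - ?h))\<^sup>2 \<le> f x"
    using smooth_convex_lower_bound[OF L f, of y x] le by (simp add: y inner_commute)
  then show decrease: ?decrease
    by (simp add: sq algebra_simps)
  \<comment> \<open>The roles of \<open>x\<close> and \<open>y\<close> are exchanged; adding this to
    the decrease cancels the values of \<open>f\<close>.\<close>
  have "f x - \<eta> * (norm ?g)\<^sup>2 + \<eta> / 2 * (norm (?g - ?h))\<^sup>2 \<le> f y"
    using smooth_convex_lower_bound[OF L f, of x y] le
    by (simp add: y power2_norm_eq_inner norm_minus_commute)
  with decrease have "\<eta> * ((norm ?h)\<^sup>2 - ?g \<bullet> ?h) \<le> 0"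
    by (simp add: sq algebra_simps)
  then have "(norm ?h)\<^sup>2 \<le> ?g \<bullet> ?h"
    using \<eta>(1) by (simp add: mult_le_0_iff)
  also have "\<dots> \<le> norm ?g * norm ?h"
    by (rule norm_cauchy_schwarz)
  finally show ?norm
    by (cases "?h = 0") (simp_all add: power2_eq_square)
qed

end

lemma gradient_descent_tilted_decrease:
  fixes f :: "'a::euclidean_space \<Rightarrow> real"
  assumes L: "L > 0" and f: "f \<in> smooth_convex L" and pos: "\<And>i. \<eta> i > 0"
    and step: "\<And>i. x (Suc i) = x i - \<eta> i *\<^sub>R gradient f (x i)"
    and small: "\<And>i. i < k \<Longrightarrow> \<eta> i \<le> 1 / L"
  shows "(\<Sum>i<k. \<eta> i) / 2 * ((norm (gradient f (x k)))\<^sup>2 - (norm p)\<^sup>2)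
    \<le> (f (x 0) - p \<bullet> x 0) - (f (x k) - p \<bullet> x k)"
  using small
proof (induction k)
  case 0
  then show ?case by simp
next
  case (Suc k)
  let ?g = "gradient f (x k)" and ?h = "gradient f (x (Suc k))" and ?a = "\<Sum>i<k. \<eta> i"
  have small: "\<eta> k \<le> 1 / L"
    using Suc.prems by simp
  have "norm ?h \<le> norm ?g"
    using norm_gradient_step_le[OF L f pos small step] .
  moreover have "?a \<ge> 0"
    using pos by (simp add: sum_nonneg less_imp_le)
  \<comment> \<open>The induction hypothesis concerns the old gradient \<open>?g\<close>;
    monotonicity of the norms lets \<open>?h\<close> replace it under the whole accumulated weight
    \<open>?a\<close>.\<close>
  ultimately have "?a / 2 * ((norm ?h)\<^sup>2 - (norm p)\<^sup>2) \<le> ?a / 2 * ((norm ?g)\<^sup>2 - (norm p)\<^sup>2)"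
    by (intro mult_left_mono diff_right_mono power_mono) auto
  also have "\<dots> \<le> (f (x 0) - p \<bullet> x 0) - (f (x k) - p \<bullet> x k)"
    using Suc by simp
  finally have IH: "?a / 2 * ((norm ?h)\<^sup>2 - (norm p)\<^sup>2)
    \<le> (f (x 0) - p \<bullet> x 0) - (f (x k) - p \<bullet> x k)" .
  \<comment> \<open>This gives Young's inequality for \<open>p \<bullet> ?g\<close>; its
    \<open>?g\<close> term cancels the one in the decrease of \<open>f\<close>, so that only
    \<open>?h\<close> remains.\<close>
  have "0 \<le> (norm (p - ?g))\<^sup>2"
    by simp
  also have "\<dots> = (norm p)\<^sup>2 - 2 * (p \<bullet> ?g) + (norm ?g)\<^sup>2"
    by (simp add: power2_norm_eq_inner inner_diff inner_commute)
  finally have "\<eta> k / 2 * (2 * (p \<bullet> ?g)) \<le> \<eta> k / 2 * ((norm p)\<^sup>2 + (norm ?g)\<^sup>2)"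
    using pos[of k] by (intro mult_left_mono) simp_all
  moreover have "p \<bullet> x (Suc k) = p \<bullet> x k - \<eta> k * (p \<bullet> ?g)"
    by (simp add: step inner_diff_right)
  moreover have "f (x (Suc k)) + \<eta> k / 2 * ((norm ?g)\<^sup>2 + (norm ?h)\<^sup>2) \<le> f (x k)"
    using gradient_step_decrease[OF L f pos small step] .
  ultimately have "\<eta> k / 2 * ((norm ?h)\<^sup>2 - (norm p)\<^sup>2)
      \<le> (f (x k) - p \<bullet> x k) - (f (x (Suc k)) - p \<bullet> x (Suc k))"
    by (simp add: algebra_simps)
  with IH show ?case
    by (simp add: add_divide_distrib distrib_right)
qed

theorem theorem3p4:
  fixes f :: "real ^ 'n \<Rightarrow> real" and L :: real and \<eta> :: "nat \<Rightarrow> real"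
    and x :: "nat \<Rightarrow> real ^ 'n" and x0 :: "real ^ 'n" and k :: nat
  assumes "L > 0"
    and "f \<in> smooth_convex L"
    and "\<And>i. \<eta> i > 0"
    and "x 0 = x0"
    and "\<And>i. x (Suc i) = x i - \<eta> i *\<^sub>R gradient f (x i)"
    and "k \<ge> 1"
    and "\<And>i. i \<le> k - 1 \<Longrightarrow> \<eta> i \<le> 1 / L"
  shows "\<forall>p \<in> conjugate_dom f.
    ereal ((norm (gradient f (x k)))\<^sup>2 - (norm p)\<^sup>2)
      \<le> 2 * dual_divergence f x0 p / ereal (\<Sum>i = 0..k - 1. \<eta> i)"
proof
  fix p
  assume "p \<in> conjugate_dom f"
  then have fin: "conjugate f p < \<infinity>"
    by (simp add: conjugate_dom_def)
  have above: "ereal (p \<bullet> x k - f (x k)) \<le> conjugate f p"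
    unfolding conjugate_def by (rule SUP_upper) simp
  \<comment> \<open>The bound \<open>above\<close> excludes minus infinity.\<close>
  obtain c where c: "conjugate f p = ereal c"
    using fin above by (cases "conjugate f p") auto
  let ?a = "\<Sum>i<k. \<eta> i" and ?G = "(norm (gradient f (x k)))\<^sup>2 - (norm p)\<^sup>2"
  \<comment> \<open>This needs \<open>k \<ge> 1\<close>: with truncated subtraction, the left sum
    for \<open>k = 0\<close> would be \<open>\<eta> 0\<close>.\<close>
  have a: "(\<Sum>i = 0..k - 1. \<eta> i) = ?a"
    using assms(6) by (intro sum.cong) auto
  have a_pos: "?a > 0"
    using assms(3,6) by (intro sum_pos) (auto simp: lessThan_empty_iff)
  have "?a / 2 * ?G \<le> (f (x 0) - p \<bullet> x 0) - (f (x k) - p \<bullet> x k)"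
    using assms by (intro gradient_descent_tilted_decrease[of L f]) auto
  \<comment> \<open>The point \<open>x k\<close> is one competitor in the supremum defining the
    conjugate.\<close>
  also have "\<dots> \<le> f x0 + c - p \<bullet> x0"
    using above c assms(4) by simp
  finally have "?G \<le> 2 * (f x0 + c - p \<bullet> x0) / ?a"
    using a_pos by (simp add: field_simps)
  moreover have "2 * dual_divergence f x0 p / ereal ?a = ereal (2 * (f x0 + c - p \<bullet> x0) / ?a)"
    using a_pos by (simp add: dual_divergence_def c)
  ultimately show "ereal ?G \<le> 2 * dual_divergence f x0 p / ereal (\<Sum>i = 0..k - 1. \<eta> i)"
    unfolding a by simp
qed

end
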